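(* Let $(F,\ell_F)\in\mathcal{G}_{or(n)}$. Then the following are equivalent: 1. There is a graph $(H,\ell_H)\in Orb_\iota(F,\ell_F)$ that is canonically self-dual, canonically self-Petrial, or canonically self-Wilsonial (respectively, canonically self-trial). 2. Every graph $(G,\ell_G)\in Orb_\iota(F,\ell_F)$ is canonically self-$\hat\gamma'$ for some $\hat\gamma'\in\mathfrak{S}^n$ every entry of which has order $2$ (respectively, $3$). 3. There exists a graph $(G,\ell_G)\in Orb_\iota(F,\ell_F)$ that is canonically self-$\hat\gamma'$ for some $\hat\gamma'\in\mathfrak{S}^n$ every entry of which has order $2$ (respectively, $3$). (That is, there are two equivalence statements: one with the first alternatives and order $2$ throughout, the other with "self-trial" and order $3$ throughout.)
   Context: **Ribbon graphs.** A (finite) ribbon graph $G=(V(G),E(G))$ is a surface with boundary presented as the union of a set $V(G)$ of discs (vertices) and a set $E(G)$ of discs (edges) such that vertices and edges intersect in disjoint line segments, each such segment lies on the boundary of precisely one vertex and precisely one edge, and every edge contains exactly two such segments. Two ribbon graphs are isomorphic if there is a homeomorphism (not required to preserve any orientation) taking vertices to vertices and edges to edges; equivalently, if the corresponding cellularly embedded graphs are isomorphic. **Arrow presentations.** A ribbon graph is encoded by drawing each vertex boundary as a circle and recording, for each edge $e$, two directed arcs (arrows) labelled $e$ on the circles, namely the two segments where $e$ meets vertices, directed by an arbitrary orientation of the boundary of the disc $e$. **Operations on one edge.** Let $A,B$ be the two arrows labelled $e$. The partial Petrial (twist) $\tau$ at $e$ reverses the direction of exactly one of $A,B$. The partial dual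 $\delta$ at $e$: draw a segment with an arrow on it labelled $e$ directed from the head of $A$ to the tail of $B$, and another with an arrow labelled $e$ directed from the head of $B$ to the tail of $A$; then delete $A$, $B$ and the arcs containing them. Vertices may change; the set of edges (labels) is unchanged. It is known that the group $\mathfrak{S} = \langle \delta,\tau \mid \delta^2,\tau^2,(\tau\delta)^3\rangle \cong S_3$ thereby acts on the left on any fixed edge (in a product the rightmost factor is applied first), and operations on distinct edges commute. **Ordered graphs.** $[n]=\{1,\dots,n\}$. $\mathcal{G}_{or(n)}$ is the set of isomorphism classes of pairs $(G,\ell)$, where $G$ is a ribbon graph with exactly $n$ edges ($n\ge 1$) and $\ell\colon[n]\to E(G)$ is a bijection (a linear ordering of the edges). $(G,\ell_G)$ and $(H,\ell_H)$ are isomorphic if there is a ribbon graph isomorphism $G\to H$ whose edge bijection $g$ satisfies $g\circ\ell_G=\ell_H$. "Graph" means an element of $\mathcal{G}_{or(n)}$. **Group action.** An element $\hat\gamma\in\mathfrak{S}^n$ is regarded as a map $[n]\to\mathfrak{S}$; multiplication and inversion in $\mathfrak{S}^n$ are entrywise, and $\hat\gamma\pi$, for $\pi\in S_n$, is composition of maps. $G^{\Gamma(\hat\gamma,\ell)}$ denotes the ribbon graph obtained from $G$ by applying to each edge $e$ the operation $\hat\gamma(\ell^{-1}(e))$. The group $\mathfrak{S}^n\rtimes S_n$, with multiplication $(\hat\gamma_1,\pi_1)(\hat\gamma_2,\pi_2)=(\hat\gamma_1\cdot\hat\gamma_2\pi_1^{-1},\pi_1\pi_2)$, acts on $\mathcal{G}_{or(n)}$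 by $(\hat\gamma,\pi)(G,\ell)=(G^{\Gamma(\hat\gamma,\ell\pi^{-1})},\ell\pi^{-1})$. The identity of $S_n$ is $\iota$. $Orb_\iota(F,\ell_F)=\{(\hat\alpha,\iota)(F,\ell_F) : \hat\alpha\in\mathfrak{S}^n\}$. **Canonical self-twuality.** $(G,\ell)$ is canonically self-$\hat\gamma$ if $(\hat\gamma,\iota)(G,\ell)=(G,\ell)$ in $\mathcal{G}_{or(n)}$. It is canonically self-dual, self-Petrial, self-Wilsonial if it is canonically self-$(g,g,\dots,g)$ with $g=\delta$, $g=\tau$, $g=\tau\delta\tau$ respectively, and canonically self-trial if this holds with $g=\delta\tau$ or $g=\tau\delta$. *)

theory Defs
  imports "HOL-Algebra.Algebra"
begin

section \<open>Ribbon graphs as arrow presentations\<close>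

text \<open>
  A ribbon graph is given by its arrow presentation.  An arrow is the pair (tail, head) of its
  end points; an edge carries two arrows, directed consistently with some orientation of the
  boundary of the edge disc.  So for an edge with arrows \<open>((a, b), (c, d))\<close> the boundary of the
  edge disc runs \<open>a \<rightarrow> b \<rightarrow> c \<rightarrow> d \<rightarrow> a\<close>, where \<open>a b\<close> and \<open>c d\<close> are the two segments shared with
  vertices.

  The circles (vertex boundaries) are encoded by \<open>arc\<close>: the complement of all arrows on the circles
  that carry arrows is a union of arcs, and \<open>arc p\<close> is the other end point of the arc that starts
  at \<open>p\<close>.  The circles are recovered by walking alternately along arrows and arcs; every
  fixed-point-free involution arises in this way.  Circles without arrows (isolated vertices)
  leave no end points, so only their number is recorded.
\<close>

type_synonym 'p arrow = "'p \<times> 'p"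

record ('p, 'e) ribbon_graph =
  edges :: "'e set"
  arrows :: "'e \<Rightarrow> 'p arrow \<times> 'p arrow"
  arc :: "'p \<Rightarrow> 'p"
  bare_circles :: nat

fun ends :: "'p arrow \<times> 'p arrow \<Rightarrow> 'p set" where
  "ends ((a, b), (c, d)) = {a, b, c, d}"

definition points :: "('p, 'e) ribbon_graph \<Rightarrow> 'p set" where
  "points G = (\<Union>e \<in> edges G. ends (arrows G e))"

definition ribbon_graph :: "('p, 'e) ribbon_graph \<Rightarrow> bool" where
  "ribbon_graph G \<longleftrightarrow>
     finite (edges G) \<and>
     (\<forall>e \<in> edges G. card (ends (arrows G e)) = 4) \<and>
     (\<forall>e \<in> edges G. \<forall>e' \<in> edges G. e \<noteq> e' \<longrightarrow> ends (arrows G e) \<inter> ends (arrows G e') = {}) \<and>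
     (\<forall>p \<in> points G. arc G p \<in> points G \<and> arc G p \<noteq> p \<and> arc G (arc G p) = p)"

text \<open>
  The naming of the two arrows and the orientation of the edge disc are arbitrary: two pairs of
  arrows describe the same edge disc iff they differ by exchanging the arrows and/or reversing both.
\<close>

fun same_edge :: "'p arrow \<times> 'p arrow \<Rightarrow> 'p arrow \<times> 'p arrow \<Rightarrow> bool" where
  "same_edge ((a, b), (c, d)) x \<longleftrightarrow>
     x \<in> {((a, b), (c, d)), ((c, d), (a, b)), ((b, a), (d, c)), ((d, c), (b, a))}"

abbreviation map_arrows :: "('p \<Rightarrow> 'q) \<Rightarrow> 'p arrow \<times> 'p arrow \<Rightarrow> 'q arrow \<times> 'q arrow" where
  "map_arrows f \<equiv> map_prod (map_prod f f) (map_prod f f)"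

definition is_iso ::
  "('p, 'e) ribbon_graph \<Rightarrow> ('q, 'f) ribbon_graph \<Rightarrow> ('p \<Rightarrow> 'q) \<Rightarrow> ('e \<Rightarrow> 'f) \<Rightarrow> bool" where
  "is_iso G H f g \<longleftrightarrow>
     bij_betw g (edges G) (edges H) \<and>
     bij_betw f (points G) (points H) \<and>
     (\<forall>e \<in> edges G. same_edge (map_arrows f (arrows G e)) (arrows H (g e))) \<and>
     (\<forall>p \<in> points G. f (arc G p) = arc H (f p)) \<and>
     bare_circles G = bare_circles H"


section \<open>Ordered graphs\<close>

text \<open>
  The edge ordering \<open>l\<close> is a function on all naturals, of which only the values on \<open>{1..n}\<close> matter.
  The isomorphism classes are formed over given types of end points and labels; if both types are
  infinite (say \<open>nat\<close>), every finite ribbon graph is represented.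
\<close>

type_synonym ('p, 'e) ordered_graph = "('p, 'e) ribbon_graph \<times> (nat \<Rightarrow> 'e)"

definition ordered_graphs :: "nat \<Rightarrow> ('p, 'e) ordered_graph set" where
  "ordered_graphs n = {(G, l). ribbon_graph G \<and> bij_betw l {1..n} (edges G)}"

definition iso_rel :: "nat \<Rightarrow> ('p, 'e) ordered_graph rel" where
  "iso_rel n =
     {((G, l), (H, m)). (G, l) \<in> ordered_graphs n \<and> (H, m) \<in> ordered_graphs n \<and>
        (\<exists>f g. is_iso G H f g \<and> (\<forall>i \<in> {1..n}. g (l i) = m i))}"

definition G_or :: "nat \<Rightarrow> ('p, 'e) ordered_graph set set" where
  "G_or n = ordered_graphs n // iso_rel n"


section \<open>The group generated by partial dual and partial Petrial\<close>

text \<open>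
  The group is realised as \<open>sym_group 3\<close>, whose multiplication is composition, with two
  transpositions as generators.
\<close>

abbreviation S3 :: "(nat \<Rightarrow> nat) monoid" where
  "S3 \<equiv> sym_group 3"

definition \<delta> :: "nat \<Rightarrow> nat" where
  "\<delta> = Transposition.transpose 1 2"

definition \<tau> :: "nat \<Rightarrow> nat" where
  "\<tau> = Transposition.transpose 2 3"

fun twist_op :: "'p arrow \<times> 'p arrow \<Rightarrow> 'p arrow \<times> 'p arrow" where
  "twist_op ((a, b), (c, d)) = ((b, a), (c, d))"

text \<open>
  For \<open>A = (a, b)\<close> and \<open>B = (c, d)\<close> the new arrows are (head of A, tail of B) and (head of B, tail
  of A).  The end points of the arrows, and the arcs outside the arrows, stay the same.
\<close>

fun dual_op :: "'p arrow \<times> 'p arrow \<Rightarrow> 'p arrow \<times> 'p arrow" where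
  "dual_op ((a, b), (c, d)) = ((b, c), (d, a))"

definition edge_op :: "(nat \<Rightarrow> nat) \<Rightarrow> 'p arrow \<times> 'p arrow \<Rightarrow> 'p arrow \<times> 'p arrow" where
  "edge_op g =
     (if g = id then id
      else if g = \<delta> then dual_op
      else if g = \<tau> then twist_op
      else if g = \<tau> \<circ> \<delta> then twist_op \<circ> dual_op
      else if g = \<delta> \<circ> \<tau> then dual_op \<circ> twist_op
      else twist_op \<circ> dual_op \<circ> twist_op)"

lemma S3_vals: "\<delta> 1 = 2" "\<delta> 2 = 1" "\<delta> 3 = 3" "\<tau> 1 = 1" "\<tau> 2 = 3" "\<tau> 3 = 2"
  by (simp_all add: \<delta>_def \<tau>_def Transposition.transpose_def)

lemma S3_distinct: "distinct [id, \<delta>, \<tau>, \<tau> \<circ> \<delta>, \<delta> \<circ> \<tau>, \<tau> \<circ> \<delta> \<circ> \<tau>]"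
proof -
  have "distinct (map (\<lambda>p. (p 1, p 2)) [id, \<delta>, \<tau>, \<tau> \<circ> \<delta>, \<delta> \<circ> \<tau>, \<tau> \<circ> \<delta> \<circ> \<tau>])"
    by (simp del: One_nat_def add: S3_vals)
  then show ?thesis unfolding distinct_map by blast
qed

lemma S3_permutes: "\<delta> permutes {1..3}" "\<tau> permutes {1..3}"
  unfolding \<delta>_def \<tau>_def by (rule permutes_swap_id; simp)+

lemma carrier_S3: "carrier S3 = {id, \<delta>, \<tau>, \<tau> \<circ> \<delta>, \<delta> \<circ> \<tau>, \<tau> \<circ> \<delta> \<circ> \<tau>}" (is "_ = ?R")
proof -
  have "?R \<subseteq> {p. p permutes {1..3}}"
    using S3_permutes by (auto intro: permutes_compose permutes_id)
  moreover have "card {p. p permutes {1..3::nat}} = 6"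
    by (subst card_permutations[of _ 3]) (auto simp: fact_numeral)
  moreover have "card ?R = 6"
    using distinct_card[OF S3_distinct] by (simp del: distinct.simps)
  ultimately have "?R = {p. p permutes {1..3}}"
    by (intro card_subset_eq) (auto intro: finite_permutations)
  then show ?thesis by (simp add: sym_group_def)
qed

lemma edge_op_simps [simp]:
  "edge_op id = id" "edge_op \<delta> = dual_op" "edge_op \<tau> = twist_op"
  "edge_op (\<tau> \<circ> \<delta>) = twist_op \<circ> dual_op" "edge_op (\<delta> \<circ> \<tau>) = dual_op \<circ> twist_op"
  "edge_op (\<tau> \<circ> \<delta> \<circ> \<tau>) = twist_op \<circ> dual_op \<circ> twist_op"
  using S3_distinct by (simp_all add: edge_op_def eq_commute)

lemma S3_relations: "\<delta> \<circ> \<delta> = id" "\<tau> \<circ> \<tau> = id" "\<delta> \<circ> \<tau> \<circ> \<delta> = \<tau> \<circ> \<delta> \<circ> \<tau>"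
  by (auto simp: \<delta>_def \<tau>_def Transposition.transpose_def fun_eq_iff)

lemma arrows_cases:
  obtains a b c d where "x = ((a, b), (c, d))"
  by (metis prod.exhaust)

lemma same_edge_refl [simp]: "same_edge x x"
  by (cases x rule: arrows_cases) simp

lemma same_edge_sym: "same_edge x y \<Longrightarrow> same_edge y x"
  by (cases x rule: arrows_cases) auto

lemma same_edge_trans: "same_edge x y \<Longrightarrow> same_edge y z \<Longrightarrow> same_edge x z"
  by (cases x rule: arrows_cases) auto

lemma same_edge_map: "same_edge x y \<Longrightarrow> same_edge (map_arrows f x) (map_arrows f y)"
  by (cases x rule: arrows_cases) auto

lemma same_edge_op:
  assumes "same_edge x y" shows "same_edge (edge_op g x) (edge_op g y)"
proof -
  have d: "same_edge (dual_op x) (dual_op y)" if "same_edge x y" for x y :: "'a arrow \<times> 'a arrow"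
    using that by (cases x rule: arrows_cases) auto
  have t: "same_edge (twist_op x) (twist_op y)" if "same_edge x y" for x y :: "'a arrow \<times> 'a arrow"
    using that by (cases x rule: arrows_cases) auto
  show ?thesis using assms by (auto simp: edge_op_def intro: d t)
qed

lemma edge_op_map: "map_arrows f (edge_op g x) = edge_op g (map_arrows f x)"
  by (cases x rule: arrows_cases) (auto simp: edge_op_def)

text \<open>Up to the identification of arrow pairs, this is a left action.\<close>

lemma edge_op_mult:
  assumes "g \<in> carrier S3" "h \<in> carrier S3"
  shows "same_edge (edge_op (g \<otimes>\<^bsub>S3\<^esub> h) x) (edge_op g (edge_op h x))"
proof -
  have gen: "same_edge (edge_op (\<delta> \<circ> h) x) (dual_op (edge_op h x))"
     "same_edge (edge_op (\<tau> \<circ> h) x) (twist_op (edge_op h x))" 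
     "\<delta> \<circ> h \<in> carrier S3" "\<tau> \<circ> h \<in> carrier S3"
    if "h \<in> carrier S3" for h x
  proof -
    obtain a b c d where x: "x = ((a, b), (c, d))" by (metis prod.exhaust)
    have 1: "\<delta> \<circ> (\<tau> \<circ> \<delta>) = \<tau> \<circ> \<delta> \<circ> \<tau>" "\<delta> \<circ> (\<delta> \<circ> \<tau>) = \<tau>" "\<delta> \<circ> (\<tau> \<circ> \<delta> \<circ> \<tau>) = \<tau> \<circ> \<delta>"
     "\<tau> \<circ> (\<tau> \<circ> \<delta>) = \<delta>" "\<tau> \<circ> (\<delta> \<circ> \<tau>) = \<tau> \<circ> \<delta> \<circ> \<tau>" "\<tau> \<circ> (\<tau> \<circ> \<delta> \<circ> \<tau>) = \<delta> \<circ> \<tau>"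
      by (auto simp: \<delta>_def \<tau>_def Transposition.transpose_def fun_eq_iff)
    show "same_edge (edge_op (\<delta> \<circ> h) x) (dual_op (edge_op h x))"
      using that unfolding carrier_S3 by (elim insertE emptyE; simp only: 1 S3_relations edge_op_simps comp_id id_comp; simp add: x)
    show "same_edge (edge_op (\<tau> \<circ> h) x) (twist_op (edge_op h x))"
      using that unfolding carrier_S3 by (elim insertE emptyE; simp only: 1 S3_relations edge_op_simps comp_id id_comp; simp add: x)
    show "\<delta> \<circ> h \<in> carrier S3" "\<tau> \<circ> h \<in> carrier S3"
      using that S3_permutes by (auto simp: sym_group_def intro: permutes_compose)
  qed
  have D: "same_edge (dual_op x) (dual_op y)" and T: "same_edge (twist_op x) (twist_op y)"
    if "same_edge x y" for x y :: "'a arrow \<times> 'a arrow"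
    using same_edge_op[OF that, of \<delta>] same_edge_op[OF that, of \<tau>] by simp_all
  note tr = same_edge_trans
  have m: "g \<otimes>\<^bsub>S3\<^esub> h = g \<circ> h" by (simp add: sym_group_def)
  have td: "same_edge (edge_op (\<tau> \<circ> (\<delta> \<circ> h)) x) (twist_op (dual_op (edge_op h x)))"
    using assms(2) by (meson gen T tr)
  have dt: "same_edge (edge_op (\<delta> \<circ> (\<tau> \<circ> h)) x) (dual_op (twist_op (edge_op h x)))"
    using assms(2) by (meson gen D tr)
  have tdt: "same_edge (edge_op (\<tau> \<circ> (\<delta> \<circ> (\<tau> \<circ> h))) x) (twist_op (dual_op (twist_op (edge_op h x))))"
    using assms(2) dt by (meson gen T tr)
  show ?thesis using assms(1) gen[OF assms(2)] td dt tdt unfolding carrier_S3 m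
    by (elim insertE emptyE;
        simp only: comp_assoc edge_op_simps[unfolded comp_assoc] comp_apply id_comp id_apply
          same_edge_refl)
qed

definition S3_pow :: "nat \<Rightarrow> (nat \<Rightarrow> nat \<Rightarrow> nat) set" where
  "S3_pow n = {1..n} \<rightarrow>\<^sub>E carrier S3"


section \<open>The action on ordered graphs\<close>

text \<open>\<open>twual n G \<gamma> l\<close> is the graph obtained by applying \<open>\<gamma> (l\<inverse> e)\<close> to every edge \<open>e\<close>.\<close>

definition twual ::
  "nat \<Rightarrow> ('p, 'e) ribbon_graph \<Rightarrow> (nat \<Rightarrow> nat \<Rightarrow> nat) \<Rightarrow> (nat \<Rightarrow> 'e) \<Rightarrow> ('p, 'e) ribbon_graph" where
  "twual n G \<gamma> l = G\<lparr>arrows := \<lambda>e. edge_op (\<gamma> (inv_into {1..n} l e)) (arrows G e)\<rparr>"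

definition act_rep ::
  "nat \<Rightarrow> (nat \<Rightarrow> nat \<Rightarrow> nat) \<times> (nat \<Rightarrow> nat) \<Rightarrow> ('p, 'e) ordered_graph \<Rightarrow> ('p, 'e) ordered_graph" where
  "act_rep n = (\<lambda>(\<gamma>, \<pi>) (G, l).
     (twual n G \<gamma> (l \<circ> Hilbert_Choice.inv \<pi>), l \<circ> Hilbert_Choice.inv \<pi>))"

definition act ::
  "nat \<Rightarrow> (nat \<Rightarrow> nat \<Rightarrow> nat) \<times> (nat \<Rightarrow> nat) \<Rightarrow> ('p, 'e) ordered_graph set \<Rightarrow> ('p, 'e) ordered_graph set"
  where "act n a C = (\<Union>x \<in> C. iso_rel n `` {act_rep n a x})"

definition Orb_id :: "nat \<Rightarrow> ('p, 'e) ordered_graph set \<Rightarrow> ('p, 'e) ordered_graph set set" where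
  "Orb_id n F = {act n (\<alpha>, id) F |\<alpha>. \<alpha> \<in> S3_pow n}"

definition canonically_self ::
  "nat \<Rightarrow> (nat \<Rightarrow> nat \<Rightarrow> nat) \<Rightarrow> ('p, 'e) ordered_graph set \<Rightarrow> bool" where
  "canonically_self n \<gamma> C \<longleftrightarrow> act n (\<gamma>, id) C = C"

definition canonically_self_dual :: "nat \<Rightarrow> ('p, 'e) ordered_graph set \<Rightarrow> bool" where
  "canonically_self_dual n C \<longleftrightarrow> canonically_self n (\<lambda>i \<in> {1..n}. \<delta>) C"

definition canonically_self_Petrial :: "nat \<Rightarrow> ('p, 'e) ordered_graph set \<Rightarrow> bool" where
  "canonically_self_Petrial n C \<longleftrightarrow> canonically_self n (\<lambda>i \<in> {1..n}. \<tau>) C"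

definition canonically_self_Wilsonial :: "nat \<Rightarrow> ('p, 'e) ordered_graph set \<Rightarrow> bool" where
  "canonically_self_Wilsonial n C \<longleftrightarrow>
     canonically_self n (\<lambda>i \<in> {1..n}. \<tau> \<otimes>\<^bsub>S3\<^esub> \<delta> \<otimes>\<^bsub>S3\<^esub> \<tau>) C"

definition canonically_self_trial :: "nat \<Rightarrow> ('p, 'e) ordered_graph set \<Rightarrow> bool" where
  "canonically_self_trial n C \<longleftrightarrow>
     canonically_self n (\<lambda>i \<in> {1..n}. \<delta> \<otimes>\<^bsub>S3\<^esub> \<tau>) C \<or>
     canonically_self n (\<lambda>i \<in> {1..n}. \<tau> \<otimes>\<^bsub>S3\<^esub> \<delta>) C"

text \<open>The action on isomorphism classes is well defined and respects the semidirect product.\<close>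

lemma ends_edge_op [simp]: "ends (edge_op g x) = ends x"
  by (cases x rule: arrows_cases) (auto simp: edge_op_def)

lemma ends_map_arrows: "ends (map_arrows f x) = f ` ends x"
  by (cases x rule: arrows_cases) auto

lemma same_edge_ends: "same_edge x y \<Longrightarrow> ends x = ends y"
  by (cases x rule: arrows_cases) auto

lemma twual_simps [simp]:
  "edges (twual n G \<gamma> l) = edges G" "arc (twual n G \<gamma> l) = arc G"
  "bare_circles (twual n G \<gamma> l) = bare_circles G" "points (twual n G \<gamma> l) = points G"
  by (simp_all add: twual_def points_def)

lemma ribbon_graph_twual [simp]: "ribbon_graph (twual n G \<gamma> l) = ribbon_graph G"
  unfolding ribbon_graph_def by (simp add: twual_def points_def)

lemma map_arrows_id [simp]: "map_arrows id x = x"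
  by (cases x rule: arrows_cases) simp

lemma map_arrows_comp: "map_arrows (f \<circ> g) x = map_arrows f (map_arrows g x)"
  by (cases x rule: arrows_cases) simp

lemma is_iso_refl: "is_iso G G id id"
  by (simp add: is_iso_def)

lemma is_iso_comp:
  assumes "is_iso G H f g" "is_iso H K f' g'"
  shows "is_iso G K (f' \<circ> f) (g' \<circ> g)"
proof -
  have "same_edge (map_arrows (f' \<circ> f) (arrows G e)) (arrows K (g' (g e)))" if e: "e \<in> edges G" for e
  proof -
    have "g e \<in> edges H" using assms e by (auto simp: is_iso_def bij_betw_def)
    then have 1: "same_edge (map_arrows f' (arrows H (g e))) (arrows K (g' (g e)))"
      using assms(2) by (simp add: is_iso_def)
    have "same_edge (map_arrows f (arrows G e)) (arrows H (g e))"
      using assms(1) e by (simp add: is_iso_def)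
    from same_edge_trans[OF same_edge_map[OF this, of f'] 1] show ?thesis
      by (simp only: map_arrows_comp)
  qed
  moreover have "f p \<in> points H" if "p \<in> points G" for p
    using assms(1) that by (auto simp: is_iso_def bij_betw_def)
  ultimately show ?thesis using assms
    unfolding is_iso_def by (auto intro: bij_betw_trans)
qed

lemma is_iso_inv:
  assumes "is_iso G H f g" "ribbon_graph G"
  shows "is_iso H G (inv_into (points G) f) (inv_into (edges G) g)" (is "is_iso H G ?f ?g")
proof -
  have f: "bij_betw f (points G) (points H)" and g: "bij_betw g (edges G) (edges H)"
    using assms(1) by (simp_all add: is_iso_def)
  have "same_edge (map_arrows ?f (arrows H e)) (arrows G (?g e))" if e: "e \<in> edges H" for e
  proof -
    have e': "?g e \<in> edges G" "g (?g e) = e"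
      using g e by (auto simp: bij_betw_def inv_into_into f_inv_into_f)
    then have "same_edge (map_arrows f (arrows G (?g e))) (arrows H e)"
      using assms(1) by (metis is_iso_def)
    from same_edge_map[OF same_edge_sym[OF this], of ?f]
    have "same_edge (map_arrows ?f (arrows H e)) (map_arrows ?f (map_arrows f (arrows G (?g e))))" .
    moreover have "ends (arrows G (?g e)) \<subseteq> points G"
      using e' by (auto simp: points_def)
    then have "map_arrows ?f (map_arrows f (arrows G (?g e))) = arrows G (?g e)"
      using f by (cases "arrows G (?g e)" rule: arrows_cases) (auto simp: bij_betw_def)
    ultimately show ?thesis by simp
  qed
  moreover have "?f (arc H p) = arc G (?f p)" if p: "p \<in> points H" for p
  proof -
    have p': "?f p \<in> points G" "f (?f p) = p"
      using f p by (auto simp: bij_betw_def inv_into_into f_inv_into_f)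
    then have "f (arc G (?f p)) = arc H p"
      using assms(1) by (metis is_iso_def)
    moreover have "arc G (?f p) \<in> points G" using assms(2) p'(1) by (simp add: ribbon_graph_def)
    ultimately show ?thesis using f by (metis bij_betw_def inv_into_f_f)
  qed
  ultimately show ?thesis using assms(1) f g
    by (simp add: is_iso_def bij_betw_inv_into)
qed

lemma iso_rel_iff:
  "((G, l), (H, m)) \<in> iso_rel n \<longleftrightarrow>
     (G, l) \<in> ordered_graphs n \<and> (H, m) \<in> ordered_graphs n \<and>
        (\<exists>f g. is_iso G H f g \<and> (\<forall>i \<in> {1..n}. g (l i) = m i))"
  by (simp add: iso_rel_def)

lemma equiv_iso_rel: "equiv (ordered_graphs n) (iso_rel n :: ('p, 'e) ordered_graph rel)"
    (is "equiv ?A ?R")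
proof (rule equivI)
  show "?R \<subseteq> ?A \<times> ?A"
    by (auto simp: iso_rel_def)
  show "refl_on ?A ?R"
    by (rule refl_onI) (auto simp: iso_rel_def intro!: exI[of _ id] is_iso_refl)
  show "sym ?R"
  proof (rule symI)
    fix x y :: "('p, 'e) ordered_graph" assume xy: "(x, y) \<in> iso_rel n"
    obtain G l H m where eq: "x = (G, l)" "y = (H, m)" by (metis prod.exhaust)
    with xy have *: "((G, l), (H, m)) \<in> iso_rel n" by simp
    then obtain f g where i: "is_iso G H f g" "\<forall>i \<in> {1..n}. g (l i) = m i"
      by (auto simp: iso_rel_iff)
    have o: "ribbon_graph G" "bij_betw l {1..n} (edges G)" 
      using * by (auto simp: iso_rel_iff ordered_graphs_def)
    have "inv_into (edges G) g (m k) = l k" if "k \<in> {1..n}" for k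
    proof -
      have "l k \<in> edges G" using o that by (auto simp: bij_betw_def)
      moreover have "inj_on g (edges G)" using i by (simp add: is_iso_def bij_betw_def)
      ultimately show ?thesis using i(2) that by (metis inv_into_f_f)
    qed
    with is_iso_inv[OF i(1) o(1)] * show "(y, x) \<in> iso_rel n"
      unfolding eq iso_rel_iff by blast
  qed
  show "trans ?R"
  proof (rule transI)
    fix x y z :: "('p, 'e) ordered_graph"
    assume xyz: "(x, y) \<in> iso_rel n" "(y, z) \<in> iso_rel n"
    obtain G l H m K k where eq: "x = (G, l)" "y = (H, m)" "z = (K, k)" by (metis prod.exhaust)
    with xyz have 1: "((G, l), (H, m)) \<in> iso_rel n" and 2: "((H, m), (K, k)) \<in> iso_rel n"
      by simp_all
    obtain f g where i: "is_iso G H f g" "\<forall>i \<in> {1..n}. g (l i) = m i"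
      using 1 by (auto simp: iso_rel_iff)
    obtain f' g' where i': "is_iso H K f' g'" "\<forall>i \<in> {1..n}. g' (m i) = k i"
      using 2 by (auto simp: iso_rel_iff)
    have "\<forall>i \<in> {1..n}. (g' \<circ> g) (l i) = k i" using i i' by simp
    with is_iso_comp[OF i(1) i'(1)] 1 2 show "(x, z) \<in> iso_rel n"
      unfolding eq iso_rel_iff by blast
  qed
qed

lemma bij_betw_comp_inv_perm:
  assumes "bij_betw l {1..n} E" "\<pi> permutes {1..n}"
  shows "bij_betw (l \<circ> Hilbert_Choice.inv \<pi>) {1..n} E"
  using bij_betw_trans[OF permutes_imp_bij[OF permutes_inv[OF assms(2)]] assms(1)] .

lemma act_rep_simp:
  "act_rep n (\<gamma>, \<pi>) (G, l) = (twual n G \<gamma> (l \<circ> Hilbert_Choice.inv \<pi>), l \<circ> Hilbert_Choice.inv \<pi>)"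
  by (simp add: act_rep_def)

lemma act_rep_in:
  assumes "x \<in> ordered_graphs n" "\<pi> permutes {1..n}"
  shows "act_rep n (\<gamma>, \<pi>) x \<in> ordered_graphs n"
  using assms by (cases x) (simp add: act_rep_simp ordered_graphs_def bij_betw_comp_inv_perm del: One_nat_def)

lemma act_rep_cong:
  assumes "(x, y) \<in> iso_rel n" "\<pi> permutes {1..n}"
  shows "(act_rep n (\<gamma>, \<pi>) x, act_rep n (\<gamma>, \<pi>) y) \<in> iso_rel n"
proof -
  obtain G l H m where xy: "x = (G, l)" "y = (H, m)" by (metis prod.exhaust)
  have o: "x \<in> ordered_graphs n" "y \<in> ordered_graphs n"
    using assms(1) xy by (auto simp: iso_rel_iff)
  obtain f g where i: "is_iso G H f g" and g: "\<forall>i \<in> {1..n}. g (l i) = m i"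
    using assms(1) xy by (auto simp: iso_rel_iff)
  define l' where "l' = l \<circ> Hilbert_Choice.inv \<pi>"
  define m' where "m' = m \<circ> Hilbert_Choice.inv \<pi>"
  have bij: "bij_betw l' {1..n} (edges G)" "bij_betw m' {1..n} (edges H)"
    using o xy assms(2) unfolding l'_def m'_def by (simp_all add: ordered_graphs_def bij_betw_comp_inv_perm del: One_nat_def)
  have g': "g (l' i) = m' i" if "i \<in> {1..n}" for i
    using g permutes_in_image[OF permutes_inv[OF assms(2)]] that by (simp add: l'_def m'_def del: One_nat_def)
  have "same_edge (map_arrows f (arrows (twual n G \<gamma> l') e)) (arrows (twual n H \<gamma> m') (g e))"
    if e: "e \<in> edges G" for e
  proof -
    obtain k where k: "k \<in> {1..n}" "e = l' k" using bij(1) e by (metis bij_betw_imp_surj_on imageE)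
    then have "inv_into {1..n} l' e = k" "inv_into {1..n} m' (g e) = k"
      using bij g'[OF k(1)] by (auto simp: bij_betw_def)
    moreover have "same_edge (map_arrows f (arrows G e)) (arrows H (g e))"
      using i e by (simp add: is_iso_def)
    ultimately show ?thesis by (simp add: twual_def edge_op_map same_edge_op)
  qed
  with i have "is_iso (twual n G \<gamma> l') (twual n H \<gamma> m') f g" by (simp add: is_iso_def)
  with g' have "\<exists>f g. is_iso (twual n G \<gamma> l') (twual n H \<gamma> m') f g \<and> (\<forall>i \<in> {1..n}. g (l' i) = m' i)"
    by blast
  with act_rep_in[OF o(1) assms(2)] act_rep_in[OF o(2) assms(2)] show ?thesis
    unfolding xy act_rep_simp iso_rel_iff l'_def m'_def by blast
qed

lemma act_class:
  assumes "x \<in> ordered_graphs n" "\<pi> permutes {1..n}"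
  shows "act n (\<gamma>, \<pi>) (iso_rel n `` {x}) = iso_rel n `` {act_rep n (\<gamma>, \<pi>) x}"
  unfolding act_def
  by (rule UN_equiv_class[OF equiv_iso_rel _ assms(1)])
    (auto simp: congruent_def intro!: equiv_class_eq[OF equiv_iso_rel] act_rep_cong assms(2))

lemma act_in_G_or:
  assumes "C \<in> G_or n" "\<pi> permutes {1..n}"
  shows "act n (\<gamma>, \<pi>) C \<in> G_or n"
  using assms unfolding G_or_def
  by (elim quotientE) (auto simp: act_class simp del: One_nat_def intro!: quotientI act_rep_in)

lemma act_mult:
  assumes "C \<in> G_or n" "\<gamma>\<^sub>1 \<in> S3_pow n" "\<gamma>\<^sub>2 \<in> S3_pow n" "\<pi>\<^sub>1 permutes {1..n}" "\<pi>\<^sub>2 permutes {1..n}"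
  shows "act n (\<gamma>\<^sub>1, \<pi>\<^sub>1) (act n (\<gamma>\<^sub>2, \<pi>\<^sub>2) C) =
    act n (\<lambda>i \<in> {1..n}. \<gamma>\<^sub>1 i \<otimes>\<^bsub>S3\<^esub> \<gamma>\<^sub>2 (Hilbert_Choice.inv \<pi>\<^sub>1 i), \<pi>\<^sub>1 \<circ> \<pi>\<^sub>2) C"
    (is "_ = act n (?\<gamma>, _) C")
proof -
  obtain G l where x: "(G, l) \<in> ordered_graphs n" and C: "C = iso_rel n `` {(G, l)}"
    using assms(1) unfolding G_or_def by (auto elim: quotientE)
  define l2 where "l2 = l \<circ> Hilbert_Choice.inv \<pi>\<^sub>2"
  define l1 where "l1 = l2 \<circ> Hilbert_Choice.inv \<pi>\<^sub>1"
  have l1: "l \<circ> Hilbert_Choice.inv (\<pi>\<^sub>1 \<circ> \<pi>\<^sub>2) = l1"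
    using assms(4,5) by (simp add: l1_def l2_def o_inv_distrib permutes_bij comp_assoc)
  have bij: "bij_betw l2 {1..n} (edges G)" "bij_betw l1 {1..n} (edges G)"
    using x assms(4,5) unfolding l1_def l2_def by (simp_all add: ordered_graphs_def bij_betw_comp_inv_perm del: One_nat_def)
  have p: "\<pi>\<^sub>1 \<circ> \<pi>\<^sub>2 permutes {1..n}" using assms(4,5) by (rule permutes_compose[rotated])
  have "same_edge (arrows (twual n G ?\<gamma> l1) e) (arrows (twual n (twual n G \<gamma>\<^sub>2 l2) \<gamma>\<^sub>1 l1) e)"
    if e: "e \<in> edges G" for e
  proof -
    obtain k where k: "k \<in> {1..n}" "e = l1 k" using bij(2) e by (metis bij_betw_imp_surj_on imageE)
    let ?k = "Hilbert_Choice.inv \<pi>\<^sub>1 k"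
    have k': "?k \<in> {1..n}" using permutes_in_image[OF permutes_inv[OF assms(4)]] k(1) by blast
    have "inv_into {1..n} l1 e = k" using bij(2) k by (auto simp: bij_betw_def)
    moreover have "inv_into {1..n} l2 e = ?k"
      using bij(1) k' k(2) unfolding l1_def comp_apply by (metis bij_betw_def inv_into_f_f)
    moreover have "\<gamma>\<^sub>1 k \<in> carrier S3" "\<gamma>\<^sub>2 ?k \<in> carrier S3"
      using assms(2,3) k(1) k' by (auto simp: S3_pow_def)
    ultimately show ?thesis using k(1) by (simp add: twual_def edge_op_mult del: One_nat_def)
  qed
  then have "is_iso (twual n G ?\<gamma> l1) (twual n (twual n G \<gamma>\<^sub>2 l2) \<gamma>\<^sub>1 l1) id id"
    by (simp add: is_iso_def)
  then have "\<exists>f g. is_iso (twual n G ?\<gamma> l1) (twual n (twual n G \<gamma>\<^sub>2 l2) \<gamma>\<^sub>1 l1) f g \<and>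
      (\<forall>i \<in> {1..n}. g (l1 i) = l1 i)"
    by (intro exI[of _ id]) simp
  then have "(act_rep n (?\<gamma>, \<pi>\<^sub>1 \<circ> \<pi>\<^sub>2) (G, l), act_rep n (\<gamma>\<^sub>1, \<pi>\<^sub>1) (act_rep n (\<gamma>\<^sub>2, \<pi>\<^sub>2) (G, l))) \<in> iso_rel n"
    using act_rep_in[OF x p, of ?\<gamma>] act_rep_in[OF act_rep_in[OF x assms(5)] assms(4), of \<gamma>\<^sub>1 \<gamma>\<^sub>2]
    unfolding act_rep_simp l1 l2_def[symmetric] l1_def[symmetric] iso_rel_iff by blast
  then show ?thesis
    unfolding C act_class[OF x assms(5)] act_class[OF x p]
      act_class[OF act_rep_in[OF x assms(5)] assms(4)]
    by (rule equiv_class_eq[OF equiv_iso_rel, symmetric])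
qed

end

theory Submission
  imports Defs
begin

text \<open>
  The reason is that in the symmetric group on three letters the order of an element determines its
  conjugacy class; the theorem reads this fact through a group action.  Applying \<open>\<alpha>\<close> to a graph conjugates
  its stabiliser in \<open>\<SS>\<^sup>n\<close> by \<open>\<alpha>\<close>: if \<open>C\<close> is canonically self-\<open>\<gamma>\<close>, then the graph obtained from \<open>C\<close> by \<open>\<alpha>\<close>
  is canonically self-\<open>\<alpha> \<gamma> \<alpha>\<inverse>\<close> (lemma \<open>canonically_self_conjugate\<close>).  Conjugation in \<open>\<SS>\<^sup>n\<close> is done
  entry by entry, with an independent conjugator for each edge, so it has two consequences.

  First, it preserves the orders of all entries.  As any two graphs of an orbit are related by some
  \<open>\<alpha>\<close>, one graph with a self-twuality of entrywise order \<open>k\<close> gives such a self-twuality to every graph of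
  the orbit.  Second, all elements of order \<open>k\<close> are conjugate when \<open>k\<close> is \<open>2\<close> or \<open>3\<close>, so the conjugators can be
  chosen to turn every entry into one and the same prescribed element \<open>g\<close>, for example
  \<open>\<delta>\<close> or \<open>\<delta> \<tau>\<close>; the resulting graph in the orbit is canonically self-\<open>(g, \<dots>, g)\<close>.
\<close>


section \<open>Orders and conjugacy in the symmetric group on three letters\<close>

lemma (in group) ord_eq_prime_iff:
  assumes "Factorial_Ring.prime p" "x \<in> carrier G"
  shows "ord x = p \<longleftrightarrow> x [^] p = \<one> \<and> x \<noteq> \<one>"
proof -
  have "ord x dvd p \<longleftrightarrow> ord x = 1 \<or> ord x = p"
    using assms(1) by (auto simp: prime_nat_iff)
  moreover have "p \<noteq> 1"
    using assms(1) by auto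
  ultimately show ?thesis
    using pow_eq_id[OF assms(2), of p] ord_eq_1[OF assms(2)] by auto
qed

lemma (in group) inv_conj_cancel:
  assumes "x \<in> carrier G" "a \<in> carrier G"
  shows "a \<otimes> x \<otimes> inv a \<otimes> a = a \<otimes> x"
  using assms by (simp add: m_assoc)

lemma (in group) pow_conj:
  assumes "x \<in> carrier G" "a \<in> carrier G"
  shows "(a \<otimes> x \<otimes> inv a) [^] (k::nat) = a \<otimes> x [^] k \<otimes> inv a"
proof (induction k)
  case (Suc k)
  then show ?case using assms by (simp add: m_assoc inv_solve_left')
qed (use assms in simp)

lemma (in group) ord_conj:
  assumes "x \<in> carrier G" "a \<in> carrier G"
  shows "ord (a \<otimes> x \<otimes> inv a) = ord x"
proof -
  have "a \<otimes> y \<otimes> inv a = \<one> \<longleftrightarrow> y = \<one>" if "y \<in> carrier G" for y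
    using assms(2) that by (simp add: inv_solve_right')
  then show ?thesis
    using assms by (subst ord_unique) (simp_all add: pow_conj pow_eq_id)
qed

lemma (in group) pow_2_3:
  assumes "x \<in> carrier G"
  shows "x [^] (2::nat) = x \<otimes> x" "x [^] (3::nat) = x \<otimes> x \<otimes> x"
  using assms by (simp_all add: numeral_2_eq_2 numeral_3_eq_3)

interpretation S3: group S3
  by (rule sym_group_is_group)

text \<open>
  Oriented from left to right and read modulo associativity, the relations form a complete rewriting
  system, whose normal forms are the six elements; the second half closes the rules under right contexts.
\<close>

lemma S3_rewrite:
  "\<delta> \<circ> \<delta> = id" "\<tau> \<circ> \<tau> = id" "\<delta> \<circ> (\<tau> \<circ> \<delta>) = \<tau> \<circ> (\<delta> \<circ> \<tau>)"
  "\<delta> \<circ> (\<delta> \<circ> z) = z" "\<tau> \<circ> (\<tau> \<circ> z) = z" "\<delta> \<circ> (\<tau> \<circ> (\<delta> \<circ> z)) = \<tau> \<circ> (\<delta> \<circ> (\<tau> \<circ> z))"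
  using S3_relations[THEN fun_cong] by (simp_all only: fun_eq_iff comp_apply id_apply simp_thms)

lemma S3_ord_2_iff:
  assumes "x \<in> carrier S3"
  shows "S3.ord x = 2 \<longleftrightarrow> x \<in> {\<delta>, \<tau>, \<tau> \<circ> \<delta> \<circ> \<tau>}"
proof -
  have "x [^]\<^bsub>S3\<^esub> (2::nat) = x \<circ> x"
    using S3.pow_2_3[OF assms] by (simp only: sym_group_mult)
  then have "S3.ord x = 2 \<longleftrightarrow> x \<circ> x = id \<and> x \<noteq> id"
    using S3.ord_eq_prime_iff[OF two_is_prime_nat assms] by (simp add: sym_group_one)
  also have "\<dots> \<longleftrightarrow> x \<in> {\<delta>, \<tau>, \<tau> \<circ> \<delta> \<circ> \<tau>}"
    using assms S3_distinct[unfolded comp_assoc] unfolding carrier_S3 comp_assoc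
    by (elim insertE emptyE; simp only: comp_assoc S3_rewrite comp_id; simp add: eq_commute)
  finally show ?thesis .
qed

lemma S3_ord_3_iff:
  assumes "x \<in> carrier S3"
  shows "S3.ord x = 3 \<longleftrightarrow> x \<in> {\<tau> \<circ> \<delta>, \<delta> \<circ> \<tau>}"
proof -
  have "x [^]\<^bsub>S3\<^esub> (3::nat) = x \<circ> x \<circ> x"
    using S3.pow_2_3[OF assms] by (simp only: sym_group_mult)
  then have "S3.ord x = 3 \<longleftrightarrow> x \<circ> x \<circ> x = id \<and> x \<noteq> id"
    using S3.ord_eq_prime_iff[of 3, OF _ assms] by (simp add: sym_group_one)
  also have "\<dots> \<longleftrightarrow> x \<in> {\<tau> \<circ> \<delta>, \<delta> \<circ> \<tau>}"
    using assms S3_distinct[unfolded comp_assoc] unfolding carrier_S3 comp_assoc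
    by (elim insertE emptyE; simp only: comp_assoc S3_rewrite comp_id; simp add: eq_commute)
  finally show ?thesis .
qed

text \<open>
  The conjugacy \<open>y = a x a\<inverse>\<close> is stated as \<open>y a = a x\<close>, the form in which it is used for the action.
  It holds because an element of order \<open>1\<close>, \<open>2\<close> or \<open>3\<close> is the identity,
  a transposition or a 3-cycle, so that the order is the cycle type.
\<close>

lemma S3_conjugate_if_ord_eq:
  assumes "x \<in> carrier S3" "y \<in> carrier S3" "S3.ord x = S3.ord y"
  shows "\<exists>a \<in> carrier S3. y \<otimes>\<^bsub>S3\<^esub> a = a \<otimes>\<^bsub>S3\<^esub> x"
proof -
  have "x = y \<or> (x \<in> {\<delta>, \<tau>, \<tau> \<circ> \<delta> \<circ> \<tau>} \<and> y \<in> {\<delta>, \<tau>, \<tau> \<circ> \<delta> \<circ> \<tau>}) \<or>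
      (x \<in> {\<tau> \<circ> \<delta>, \<delta> \<circ> \<tau>} \<and> y \<in> {\<tau> \<circ> \<delta>, \<delta> \<circ> \<tau>})"
    using assms S3_ord_2_iff[of x] S3_ord_2_iff[of y] S3_ord_3_iff[of x] S3_ord_3_iff[of y]
    unfolding carrier_S3 by auto
  then show ?thesis
  proof (elim disjE)
    assume "x = y"
    then show ?thesis using assms by blast
  next
    assume "x \<in> {\<delta>, \<tau>, \<tau> \<circ> \<delta> \<circ> \<tau>} \<and> y \<in> {\<delta>, \<tau>, \<tau> \<circ> \<delta> \<circ> \<tau>}"
    \<comment> \<open>\<open>x y x\<close> is \<open>x\<close> itself if \<open>x = y\<close>, and otherwise the third transposition, and conjugation by that one exchanges \<open>x\<close> and \<open>y\<close>\<close>
    then have "y \<circ> (x \<circ> y \<circ> x) = x \<circ> y \<circ> x \<circ> x"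
      by (elim conjE insertE emptyE) (simp_all add: comp_assoc S3_rewrite)
    moreover have "x \<circ> y \<circ> x \<in> carrier S3"
      using S3.m_closed[OF S3.m_closed[OF assms(1,2)] assms(1)] by (simp only: sym_group_mult)
    ultimately show ?thesis
      unfolding sym_group_mult by blast
  next
    assume "x \<in> {\<tau> \<circ> \<delta>, \<delta> \<circ> \<tau>} \<and> y \<in> {\<tau> \<circ> \<delta>, \<delta> \<circ> \<tau>}"
    \<comment> \<open>the two 3-cycles are mutually inverse, and conjugation by a transposition inverts a 3-cycle\<close>
    then have "y \<circ> \<tau> = \<tau> \<circ> x \<or> y \<circ> id = id \<circ> x"
      by (auto simp: comp_assoc S3_rewrite)
    then show ?thesis
      unfolding sym_group_mult carrier_S3 by blast
  qed
qed


section \<open>The action of tuples of edge operations\<close>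

lemma S3_pow_restrictI:
  "(\<And>i. i \<in> {1..n} \<Longrightarrow> f i \<in> carrier S3) \<Longrightarrow> (\<lambda>i \<in> {1..n}. f i) \<in> S3_pow n"
  by (simp add: S3_pow_def del: One_nat_def)

lemma S3_pow_apply: "\<alpha> \<in> S3_pow n \<Longrightarrow> i \<in> {1..n} \<Longrightarrow> \<alpha> i \<in> carrier S3"
  by (auto simp: S3_pow_def)

lemma act_act:
  assumes "C \<in> G_or n" "\<alpha> \<in> S3_pow n" "\<beta> \<in> S3_pow n"
  shows "act n (\<alpha>, id) (act n (\<beta>, id) C) = act n (\<lambda>i \<in> {1..n}. \<alpha> i \<otimes>\<^bsub>S3\<^esub> \<beta> i, id) C"
  using act_mult[OF assms permutes_id permutes_id] by (simp del: One_nat_def)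

lemma act_one:
  assumes "C \<in> G_or n"
  shows "act n (\<lambda>i \<in> {1..n}. \<one>\<^bsub>S3\<^esub>, id) C = C"
proof -
  obtain G l where x: "(G, l) \<in> ordered_graphs n" and C: "C = iso_rel n `` {(G, l)}"
    using assms unfolding G_or_def by (auto elim: quotientE)
  let ?\<gamma> = "\<lambda>i \<in> {1..n}. \<one>\<^bsub>S3\<^esub>"
  have "inv_into {1..n} l e \<in> {1..n}" if "e \<in> edges G" for e
    using x that by (metis (mono_tags, lifting) bij_betw_imp_surj_on case_prodD inv_into_into mem_Collect_eq ordered_graphs_def)
  then have "arrows (twual n G ?\<gamma> l) e = arrows G e" if "e \<in> edges G" for e
    using that by (simp add: twual_def sym_group_one del: One_nat_def)
  then have "is_iso G (twual n G ?\<gamma> l) id id"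
    by (simp add: is_iso_def)
  then have "\<exists>f g. is_iso G (twual n G ?\<gamma> l) f g \<and> (\<forall>i \<in> {1..n}. g (l i) = l i)"
    by (intro exI[of _ id]) simp
  then have "((G, l), act_rep n (?\<gamma>, id) (G, l)) \<in> iso_rel n"
    using x act_rep_in[OF x permutes_id, of ?\<gamma>] by (simp add: act_rep_simp iso_rel_iff del: One_nat_def)
  then show ?thesis
    unfolding C act_class[OF x permutes_id] by (rule equiv_class_eq[OF equiv_iso_rel, symmetric])
qed

lemma Orb_id_subset: "F \<in> G_or n \<Longrightarrow> Orb_id n F \<subseteq> G_or n"
  using act_in_G_or[OF _ permutes_id] by (auto simp: Orb_id_def)

lemma Orb_id_self:
  assumes "F \<in> G_or n"
  shows "F \<in> Orb_id n F"
  using act_one[OF assms] S3_pow_restrictI[of n "\<lambda>_. \<one>\<^bsub>S3\<^esub>"]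
  unfolding Orb_id_def by (force simp del: One_nat_def)

lemma Orb_id_closed:
  assumes "F \<in> G_or n" "G \<in> Orb_id n F" "\<alpha> \<in> S3_pow n"
  shows "act n (\<alpha>, id) G \<in> Orb_id n F"
proof -
  obtain \<beta> where "\<beta> \<in> S3_pow n" "G = act n (\<beta>, id) F"
    using assms(2) by (auto simp: Orb_id_def)
  then show ?thesis
    using act_act[OF assms(1,3)] S3_pow_restrictI[of n "\<lambda>i. \<alpha> i \<otimes>\<^bsub>S3\<^esub> \<beta> i"] assms(3)
    by (auto simp: Orb_id_def S3_pow_apply simp del: One_nat_def)
qed

lemma Orb_id_transitive:
  assumes F: "F \<in> G_or n" and G: "G \<in> Orb_id n F" and H: "H \<in> Orb_id n F"
  obtains \<alpha> where "\<alpha> \<in> S3_pow n" "H = act n (\<alpha>, id) G"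
proof -
  obtain \<beta> where \<beta>: "\<beta> \<in> S3_pow n" "G = act n (\<beta>, id) F"
    using G by (auto simp: Orb_id_def)
  obtain \<gamma> where \<gamma>: "\<gamma> \<in> S3_pow n" "H = act n (\<gamma>, id) F"
    using H by (auto simp: Orb_id_def)
  let ?\<beta>' = "\<lambda>i \<in> {1..n}. inv\<^bsub>S3\<^esub> \<beta> i"
  have \<beta>': "?\<beta>' \<in> S3_pow n"
    by (intro S3_pow_restrictI S3.inv_closed S3_pow_apply[OF \<beta>(1)])
  have "act n (?\<beta>', id) G = act n (\<lambda>i \<in> {1..n}. ?\<beta>' i \<otimes>\<^bsub>S3\<^esub> \<beta> i, id) F"
    unfolding \<beta>(2) by (rule act_act[OF F \<beta>' \<beta>(1)])
  also have "(\<lambda>i \<in> {1..n}. ?\<beta>' i \<otimes>\<^bsub>S3\<^esub> \<beta> i) = (\<lambda>i \<in> {1..n}. \<one>\<^bsub>S3\<^esub>)"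
    by (intro restrict_ext) (simp only: restrict_apply if_True S3.l_inv S3_pow_apply[OF \<beta>(1)])
  finally have "act n (?\<beta>', id) G = F"
    by (simp only: act_one[OF F])
  then have "H = act n (\<gamma>, id) (act n (?\<beta>', id) G)"
    using \<gamma>(2) by simp
  also have "\<dots> = act n (\<lambda>i \<in> {1..n}. \<gamma> i \<otimes>\<^bsub>S3\<^esub> ?\<beta>' i, id) G"
    using F G Orb_id_subset by (intro act_act \<gamma>(1) \<beta>') blast
  finally have "H = act n (\<lambda>i \<in> {1..n}. \<gamma> i \<otimes>\<^bsub>S3\<^esub> ?\<beta>' i, id) G" .
  moreover have "(\<lambda>i \<in> {1..n}. \<gamma> i \<otimes>\<^bsub>S3\<^esub> ?\<beta>' i) \<in> S3_pow n"
    using \<gamma>(1) \<beta>' by (intro S3_pow_restrictI) (simp add: S3_pow_apply del: One_nat_def restrict_apply)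
  ultimately show thesis using that by blast
qed


section \<open>Canonical self-twuality along an orbit\<close>

text \<open>
  The equation \<open>\<beta> \<alpha> = \<alpha> \<gamma>\<close> is the inverse-free form of \<open>\<beta> = \<alpha> \<gamma> \<alpha>\<inverse>\<close>, and it is exactly what
  lets \<open>\<beta>\<close> be moved past \<open>\<alpha>\<close>: applying \<open>\<beta>\<close> after \<open>\<alpha>\<close> is applying \<open>\<alpha>\<close> after \<open>\<gamma>\<close>, and \<open>\<gamma>\<close> does nothing.
\<close>

lemma canonically_self_conjugate:
  assumes "C \<in> G_or n" "\<alpha> \<in> S3_pow n" "\<beta> \<in> S3_pow n" "\<gamma> \<in> S3_pow n"
    and "\<And>i. i \<in> {1..n} \<Longrightarrow> \<beta> i \<otimes>\<^bsub>S3\<^esub> \<alpha> i = \<alpha> i \<otimes>\<^bsub>S3\<^esub> \<gamma> i"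
    and "canonically_self n \<gamma> C"
  shows "canonically_self n \<beta> (act n (\<alpha>, id) C)"
proof -
  have "act n (\<beta>, id) (act n (\<alpha>, id) C) = act n (\<lambda>i \<in> {1..n}. \<beta> i \<otimes>\<^bsub>S3\<^esub> \<alpha> i, id) C"
    using assms(1,3,2) by (rule act_act)
  also have "(\<lambda>i \<in> {1..n}. \<beta> i \<otimes>\<^bsub>S3\<^esub> \<alpha> i) = (\<lambda>i \<in> {1..n}. \<alpha> i \<otimes>\<^bsub>S3\<^esub> \<gamma> i)"
    using assms(5) by (rule restrict_ext)
  also have "act n (\<lambda>i \<in> {1..n}. \<alpha> i \<otimes>\<^bsub>S3\<^esub> \<gamma> i, id) C = act n (\<alpha>, id) (act n (\<gamma>, id) C)"
    using assms(1,2,4) by (rule act_act[symmetric])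
  also have "act n (\<gamma>, id) C = C"
    using assms(6) by (simp add: canonically_self_def)
  finally show ?thesis unfolding canonically_self_def .
qed

text \<open>
  Conjugation by the tuple that takes \<open>G\<close> to \<open>H\<close> turns a self-twuality of \<open>G\<close> into one of \<open>H\<close>
  and leaves the order of each entry alone.
\<close>

lemma self_twuality_of_order_transfer:
  assumes F: "F \<in> G_or n" and G: "G \<in> Orb_id n F" and H: "H \<in> Orb_id n F"
    and \<gamma>: "\<gamma> \<in> S3_pow n" "\<forall>i \<in> {1..n}. S3.ord (\<gamma> i) = k" "canonically_self n \<gamma> G"
  shows "\<exists>\<beta> \<in> S3_pow n. (\<forall>i \<in> {1..n}. S3.ord (\<beta> i) = k) \<and> canonically_self n \<beta> H"
proof -
  obtain \<alpha> where \<alpha>: "\<alpha> \<in> S3_pow n" and H': "H = act n (\<alpha>, id) G"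
    using F G H by (rule Orb_id_transitive)
  let ?\<beta> = "\<lambda>i \<in> {1..n}. \<alpha> i \<otimes>\<^bsub>S3\<^esub> \<gamma> i \<otimes>\<^bsub>S3\<^esub> inv\<^bsub>S3\<^esub> \<alpha> i"
  have \<beta>: "?\<beta> \<in> S3_pow n"
    by (intro S3_pow_restrictI S3.m_closed S3.inv_closed S3_pow_apply[OF \<alpha>] S3_pow_apply[OF \<gamma>(1)])
  have "canonically_self n ?\<beta> H"
    unfolding H'
  proof (rule canonically_self_conjugate[OF _ \<alpha> \<beta> \<gamma>(1) _ \<gamma>(3)])
    show "G \<in> G_or n" using F G Orb_id_subset by blast
  next
    fix i assume "i \<in> {1..n}"
    then show "?\<beta> i \<otimes>\<^bsub>S3\<^esub> \<alpha> i = \<alpha> i \<otimes>\<^bsub>S3\<^esub> \<gamma> i"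
      by (simp only: restrict_apply if_True S3.inv_conj_cancel S3_pow_apply[OF \<alpha>] S3_pow_apply[OF \<gamma>(1)])
  qed
  moreover have "S3.ord (?\<beta> i) = k" if "i \<in> {1..n}" for i
    using that bspec[OF \<gamma>(2) that]
    by (simp only: restrict_apply if_True S3.ord_conj S3_pow_apply[OF \<alpha>] S3_pow_apply[OF \<gamma>(1)])
  ultimately show ?thesis using \<beta> by blast
qed

text \<open>
  The conjugator is chosen separately at each edge, which is possible because every entry of \<open>\<gamma>\<close> has
  the order of \<open>g\<close> and is therefore conjugate to \<open>g\<close>.
\<close>

lemma constant_self_twuality_in_orbit:
  assumes F: "F \<in> G_or n" and G: "G \<in> Orb_id n F" and g: "g \<in> carrier S3"
    and \<gamma>: "\<gamma> \<in> S3_pow n" "\<forall>i \<in> {1..n}. S3.ord (\<gamma> i) = S3.ord g" "canonically_self n \<gamma> G"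
  shows "\<exists>H \<in> Orb_id n F. canonically_self n (\<lambda>i \<in> {1..n}. g) H"
proof -
  have "\<forall>i \<in> {1..n}. \<exists>a \<in> carrier S3. g \<otimes>\<^bsub>S3\<^esub> a = a \<otimes>\<^bsub>S3\<^esub> \<gamma> i"
    using S3_conjugate_if_ord_eq S3_pow_apply[OF \<gamma>(1)] g \<gamma>(2) by blast
  then obtain a where a: "\<And>i. i \<in> {1..n} \<Longrightarrow> a i \<in> carrier S3 \<and> g \<otimes>\<^bsub>S3\<^esub> a i = a i \<otimes>\<^bsub>S3\<^esub> \<gamma> i"
    by metis
  let ?\<alpha> = "\<lambda>i \<in> {1..n}. a i" and ?g = "\<lambda>i \<in> {1..n}. g"
  have \<alpha>: "?\<alpha> \<in> S3_pow n" and g': "?g \<in> S3_pow n"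
    using a g by (auto intro!: S3_pow_restrictI simp del: One_nat_def)
  have "canonically_self n ?g (act n (?\<alpha>, id) G)"
    using F G Orb_id_subset a
    by (intro canonically_self_conjugate[OF _ \<alpha> g' \<gamma>(1) _ \<gamma>(3)]) (auto simp del: One_nat_def)
  then show ?thesis
    using Orb_id_closed[OF F G \<alpha>] by blast
qed

text \<open>
  The predicate \<open>const\<close> covers both families of named self-twualities: for \<open>k = 2\<close> the
  element \<open>h\<close> ranges over the dual, the Petrial and the Wilsonial operation, for \<open>k = 3\<close> over the two trialities.
  The given element \<open>g\<close> of order \<open>k\<close> is the target to which all entries are conjugated.
\<close>

lemma self_twuality_of_order_equivalences:
  fixes n k :: nat and F :: "('p, 'e) ordered_graph set"
  assumes F: "F \<in> G_or n" and g: "g \<in> carrier S3" "S3.ord g = k"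
  defines "P \<equiv> \<lambda>G. \<exists>\<gamma> \<in> S3_pow n. (\<forall>i \<in> {1..n}. S3.ord (\<gamma> i) = k) \<and> canonically_self n \<gamma> G"
  defines "const \<equiv> \<lambda>H. \<exists>h \<in> carrier S3. S3.ord h = k \<and> canonically_self n (\<lambda>i \<in> {1..n}. h) H"
  shows "((\<exists>H \<in> Orb_id n F. const H) \<longleftrightarrow> (\<forall>G \<in> Orb_id n F. P G)) \<and>
    ((\<forall>G \<in> Orb_id n F. P G) \<longleftrightarrow> (\<exists>G \<in> Orb_id n F. P G))"
proof -
  have 1: "P H" if "const H" for H
  proof -
    obtain h where h: "h \<in> carrier S3" "S3.ord h = k" "canonically_self n (\<lambda>i \<in> {1..n}. h) H"
      using \<open>const H\<close> by (auto simp: const_def)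
    show ?thesis unfolding P_def
      by (rule bexI[of _ "\<lambda>i \<in> {1..n}. h"]) (use h S3_pow_restrictI in \<open>simp_all del: One_nat_def\<close>)
  qed
  have 2: "P H" if "G \<in> Orb_id n F" "P G" "H \<in> Orb_id n F" for G H
    using self_twuality_of_order_transfer[OF F that(1,3)] that(2) unfolding P_def by blast
  have 3: "\<exists>H \<in> Orb_id n F. const H" if "G \<in> Orb_id n F" "P G" for G
    using constant_self_twuality_in_orbit[OF F that(1) g(1)] that(2) g unfolding P_def const_def by blast
  show ?thesis using 1 2 3 Orb_id_self[OF F] by blast
qed

theorem theorem5p3:
  fixes n :: nat and F :: "('p, 'e) ordered_graph set"
  assumes "n \<ge> 1" and "F \<in> G_or n"
  shows
    "(((\<exists>H \<in> Orb_id n F.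
           canonically_self_dual n H \<or> canonically_self_Petrial n H \<or> canonically_self_Wilsonial n H)
        \<longleftrightarrow>
        (\<forall>G \<in> Orb_id n F. \<exists>\<gamma> \<in> S3_pow n.
           (\<forall>i \<in> {1..n}. group.ord S3 (\<gamma> i) = 2) \<and> canonically_self n \<gamma> G))
      \<and>
      ((\<forall>G \<in> Orb_id n F. \<exists>\<gamma> \<in> S3_pow n.
           (\<forall>i \<in> {1..n}. group.ord S3 (\<gamma> i) = 2) \<and> canonically_self n \<gamma> G)
        \<longleftrightarrow>
        (\<exists>G \<in> Orb_id n F. \<exists>\<gamma> \<in> S3_pow n.
           (\<forall>i \<in> {1..n}. group.ord S3 (\<gamma> i) = 2) \<and> canonically_self n \<gamma> G)))
     \<and>
     (((\<exists>H \<in> Orb_id n F. canonically_self_trial n H)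
        \<longleftrightarrow>
        (\<forall>G \<in> Orb_id n F. \<exists>\<gamma> \<in> S3_pow n.
           (\<forall>i \<in> {1..n}. group.ord S3 (\<gamma> i) = 3) \<and> canonically_self n \<gamma> G))
      \<and>
      ((\<forall>G \<in> Orb_id n F. \<exists>\<gamma> \<in> S3_pow n.
           (\<forall>i \<in> {1..n}. group.ord S3 (\<gamma> i) = 3) \<and> canonically_self n \<gamma> G)
        \<longleftrightarrow>
        (\<exists>G \<in> Orb_id n F. \<exists>\<gamma> \<in> S3_pow n.
           (\<forall>i \<in> {1..n}. group.ord S3 (\<gamma> i) = 3) \<and> canonically_self n \<gamma> G)))"
proof -
  have dual: "\<delta> \<in> carrier S3" "S3.ord \<delta> = 2" and trial: "\<tau> \<circ> \<delta> \<in> carrier S3" "S3.ord (\<tau> \<circ> \<delta>) = 3"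
    and others: "\<tau> \<in> carrier S3" "\<tau> \<circ> \<delta> \<circ> \<tau> \<in> carrier S3" "\<delta> \<circ> \<tau> \<in> carrier S3"
    using S3_ord_2_iff[of \<delta>] S3_ord_3_iff[of "\<tau> \<circ> \<delta>"] carrier_S3 by blast+
  have "(\<exists>g \<in> carrier S3. S3.ord g = 2 \<and> Q g) \<longleftrightarrow> Q \<delta> \<or> Q \<tau> \<or> Q (\<tau> \<circ> \<delta> \<circ> \<tau>)" for Q
    using S3_ord_2_iff dual(1) others(1,2) by blast
  then have order_2: "(\<exists>g \<in> carrier S3. S3.ord g = 2 \<and> canonically_self n (\<lambda>i \<in> {1..n}. g) H) \<longleftrightarrow>
      canonically_self_dual n H \<or> canonically_self_Petrial n H \<or> canonically_self_Wilsonial n H"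
    for H :: "('p, 'e) ordered_graph set"
    unfolding canonically_self_dual_def canonically_self_Petrial_def canonically_self_Wilsonial_def
      sym_group_mult .
  have "(\<exists>g \<in> carrier S3. S3.ord g = 3 \<and> Q g) \<longleftrightarrow> Q (\<delta> \<circ> \<tau>) \<or> Q (\<tau> \<circ> \<delta>)" for Q
    using S3_ord_3_iff trial(1) others(3) by blast
  then have order_3: "(\<exists>g \<in> carrier S3. S3.ord g = 3 \<and> canonically_self n (\<lambda>i \<in> {1..n}. g) H) \<longleftrightarrow>
      canonically_self_trial n H" for H :: "('p, 'e) ordered_graph set"
    unfolding canonically_self_trial_def sym_group_mult .
  show ?thesis
    using self_twuality_of_order_equivalences[OF assms(2) dual]
      self_twuality_of_order_equivalences[OF assms(2) trial]
    unfolding order_2 order_3 by (rule conjI)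
qed

end
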